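(* The 2-color Rado number of $L(m,3)$ equals $C(m,3)=\left\lceil \frac{m-1}{3}\left\lceil \frac{m-1}{3}\right\rceil\right\rceil$ for every integer $m\geq 7$. For $m=6,5,4,3$ the 2-color Rado number of $L(m,3)$ is $5,4,1,9$, respectively.
   Context: For integers $m\geq 3$, $a\geq 1$, $L(m,a)$ denotes the equation $x_1+x_2+\cdots+x_{m-1}=a x_m$. For a positive integer $n$, $[n]=\{1,\dots,n\}$. A solution of $L(m,a)$ in $[n]$ is an $m$-tuple $(x_1,\dots,x_m)\in[n]^m$ (entries not necessarily distinct) satisfying the equation; given a 2-coloring of $[n]$, it is monochromatic if all $x_i$ have the same color. The 2-color Rado number of $L(m,a)$ is the least positive integer $n$ such that every 2-coloring of $[n]$ admits a monochromatic solution of $L(m,a)$ in $[n]$. *)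

theory Defs
  imports Complex_Main
begin

(* A solution of L(m,a): x_1+...+x_{m-1} = a*x_m, represented as a list xs of
   length m, xs!0..xs!(m-2) are x_1..x_{m-1} and xs!(m-1) is x_m. *)
definition is_solution_L :: "nat \<Rightarrow> nat \<Rightarrow> nat list \<Rightarrow> bool" where
  "is_solution_L m a xs \<longleftrightarrow> length xs = m \<and>
     (\<Sum>i<m - 1. xs ! i) = a * xs ! (m - 1)"

definition rado_property :: "nat \<Rightarrow> nat \<Rightarrow> nat \<Rightarrow> bool" where
  "rado_property m a n \<longleftrightarrow>
     (\<forall>c :: nat \<Rightarrow> bool. \<exists>xs. is_solution_L m a xs \<and> set xs \<subseteq> {1..n} \<and>
        (\<exists>b. \<forall>x\<in>set xs. c x = b))"

definition is_rado_number :: "nat \<Rightarrow> nat \<Rightarrow> nat \<Rightarrow> bool" where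
  "is_rado_number m a n \<longleftrightarrow> n \<ge> 1 \<and> rado_property m a n \<and>
     (\<forall>k. 1 \<le> k \<and> k < n \<longrightarrow> \<not> rado_property m a k)"

end

theory Submission
  imports Defs
begin

text \<open>
  Write k = m - 1 and q for the ceiling of k/3. Separating the numbers below q from the others
  gives the lower bound. For the upper bound, call a number red if it has the colour of 1 and blue
  otherwise, and let k \<ge> 7. If 1, ..., y - 1 are red, then every x between k - 2 and
  (k - 2)(y - 1) is blue, because 3x is x + x plus a sum of k - 2 numbers below y; in particular
  k - 2 is blue.

  \<^item> If 2 and 3 are blue, then 3(k - 2) is a sum of k twos and threes.
  \<^item> If 2 is blue and 3 is red, every x of the same parity as k with k \<le> 3x \<le> 3k is blue, and
    3k is the sum of k - 3 twos and three such numbers.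
  \<^item> If 2 is red, let y be the least blue number, so that 3 \<le> y \<le> q. The least Z with
    3Z \<ge> (k - 1)y + q is blue and at most the claimed Rado number, and 3Z is the sum of k - 1
    copies of y and one of the blue numbers q, q + 1, q + 2.
\<close>

lemma exists_list_sum_in_interval:
  fixes lo hi s k :: nat
  assumes "k * lo \<le> s" "s \<le> k * hi" "lo \<le> hi"
  shows "\<exists>ys. length ys = k \<and> set ys \<subseteq> {lo..hi} \<and> sum_list ys = s"
  using assms(1,2)
proof (induction k arbitrary: s)
  case 0
  then show ?case by simp
next
  case (Suc k)
  define x where "x = min hi (s - k * lo)"
  have x: "lo \<le> x" "x \<le> hi" "x \<le> s" and rest: "k * lo \<le> s - x" "s - x \<le> k * hi"
    using Suc.prems mult_le_mono2[OF assms(3), of k] assms(3) by (auto simp: x_def min_def)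
  obtain ys where "length ys = k" "set ys \<subseteq> {lo..hi}" "sum_list ys = s - x"
    using Suc.IH[OF rest] by blast
  with x show ?case
    by (intro exI[of _ "x # ys"]) auto
qed

lemma length_mult_le_sum_list:
  fixes ys :: "nat list"
  assumes "\<And>y. y \<in> set ys \<Longrightarrow> lo \<le> y"
  shows "length ys * lo \<le> sum_list ys"
  using sum_list_mono[of ys "\<lambda>_. lo" "\<lambda>y. y"] assms by (simp add: sum_list_triv)

lemma sum_list_mod_const:
  fixes ys :: "nat list"
  assumes "\<And>y. y \<in> set ys \<Longrightarrow> y mod d = r"
  shows "sum_list ys mod d = length ys * r mod d"
  using assms
proof (induction ys)
  case (Cons y ys)
  have "sum_list (y # ys) mod d = (y mod d + sum_list ys mod d) mod d"
    by (simp add: mod_add_eq)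
  also have "\<dots> = (r + length ys * r) mod d"
    using Cons by (simp add: mod_add_right_eq)
  finally show ?case by simp
qed simp

lemma is_solution_L_snoc_iff:
  "is_solution_L (Suc k) a (ys @ [x]) \<longleftrightarrow> length ys = k \<and> sum_list ys = a * x"
  by (auto simp: is_solution_L_def sum_list_sum_nth atLeast0LessThan nth_append)

locale solution_free_colouring =
  fixes k a n :: nat and c :: "nat \<Rightarrow> bool"
  assumes not_monochromatic: "\<lbrakk>length ys = k; sum_list ys = a * x; x \<in> {1..n}; set ys \<subseteq> {1..n}\<rbrakk>
    \<Longrightarrow> \<exists>y\<in>set ys. c y \<noteq> c x"

lemma rado_property_iff:
  "rado_property (Suc k) a n \<longleftrightarrow> (\<forall>c. \<not> solution_free_colouring k a n c)"
proof -
  have "(\<exists>xs. is_solution_L (Suc k) a xs \<and> set xs \<subseteq> {1..n} \<and> (\<exists>b. \<forall>x\<in>set xs. c x = b)) \<longleftrightarrow>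
    \<not> solution_free_colouring k a n c" (is "?L \<longleftrightarrow> _") for c :: "nat \<Rightarrow> bool"
  proof
    assume ?L
    then obtain xs b where xs: "is_solution_L (Suc k) a xs" "set xs \<subseteq> {1..n}" "\<forall>x\<in>set xs. c x = b"
      by blast
    then obtain ys x where "xs = ys @ [x]"
      by (metis is_solution_L_def length_Suc_conv_rev)
    with xs show "\<not> solution_free_colouring k a n c"
      by (auto simp: is_solution_L_snoc_iff solution_free_colouring_def)
  next
    assume "\<not> solution_free_colouring k a n c"
    then obtain ys x where "is_solution_L (Suc k) a (ys @ [x])" "set (ys @ [x]) \<subseteq> {1..n}"
      "\<forall>y\<in>set (ys @ [x]). c y = c x"
      by (auto simp: is_solution_L_snoc_iff solution_free_colouring_def)
    then show ?L by blast
  qed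
  then show ?thesis by (simp add: rado_property_def)
qed

lemma solution_free_colouringI:
  assumes "\<And>ys x b. \<lbrakk>length ys = k; sum_list ys = a * x; set (x # ys) \<subseteq> {z \<in> {1..n}. c z = b}\<rbrakk>
    \<Longrightarrow> False"
  shows "solution_free_colouring k a n c"
proof
  fix ys :: "nat list" and x
  assume "length ys = k" "sum_list ys = a * x" "x \<in> {1..n}" "set ys \<subseteq> {1..n}"
  then have "\<not> (\<forall>y\<in>set ys. c y = c x)"
    using assms[of ys x "c x"] by (auto simp: subset_iff)
  then show "\<exists>y\<in>set ys. c y \<noteq> c x" by blast
qed

lemma solution_free_colouring_antimono:
  assumes "solution_free_colouring k a n c" "n' \<le> n"
  shows "solution_free_colouring k a n' c"
proof
  fix ys :: "nat list" and x
  assume "length ys = k" "sum_list ys = a * x" "x \<in> {1..n'}" "set ys \<subseteq> {1..n'}"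
  moreover from this have "x \<in> {1..n}" "set ys \<subseteq> {1..n}"
    using assms(2) by auto
  ultimately show "\<exists>y\<in>set ys. c y \<noteq> c x"
    using solution_free_colouring.not_monochromatic[OF assms(1)] by blast
qed

lemma is_rado_number_SucI:
  assumes "solution_free_colouring k a n c" "\<And>c. \<not> solution_free_colouring k a (Suc n) c"
  shows "is_rado_number (Suc k) a (Suc n)"
  using assms solution_free_colouring_antimono[OF assms(1)]
  unfolding is_rado_number_def rado_property_iff less_Suc_eq_le by auto

definition ceil_div :: "nat \<Rightarrow> nat \<Rightarrow> nat" where
  "ceil_div n d = nat \<lceil>real n / real d\<rceil>"

lemma ceil_div_le_iff:
  assumes "0 < d"
  shows "ceil_div n d \<le> x \<longleftrightarrow> n \<le> d * x"
proof -
  have "ceil_div n d \<le> x \<longleftrightarrow> real n \<le> real (d * x)"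
    using assms by (simp add: ceil_div_def nat_ceiling_le_eq divide_le_eq mult.commute)
  then show ?thesis by (simp only: of_nat_le_iff)
qed

lemma less_ceil_div_iff: "0 < d \<Longrightarrow> x < ceil_div n d \<longleftrightarrow> d * x < n"
  using ceil_div_le_iff[of d n x] by linarith

lemma le_mult_ceil_div: "0 < d \<Longrightarrow> n \<le> d * ceil_div n d"
  using ceil_div_le_iff[of d n "ceil_div n d"] by simp

lemma mult_ceil_div_less:
  assumes "0 < d"
  shows "d * ceil_div n d < n + d"
  using less_ceil_div_iff[OF assms, of "ceil_div n d - 1" n] assms
  by (cases "ceil_div n d") auto

text \<open>C(m, a) for m = k + 1.\<close>

definition rado_bound :: "nat \<Rightarrow> nat \<Rightarrow> nat" where
  "rado_bound k a = ceil_div (k * ceil_div k a) a"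

lemma rado_bound_eq_ceiling:
  "rado_bound k a = nat \<lceil>real k / real a * real_of_int \<lceil>real k / real a\<rceil>\<rceil>"
  by (simp add: rado_bound_def ceil_div_def)

lemma solution_free_colouring_below_rado_bound:
  assumes "0 < a" "n < rado_bound k a"
  shows "solution_free_colouring k a n (\<lambda>x. x < ceil_div k a)"
proof (rule solution_free_colouringI)
  fix ys :: "nat list" and x b
  assume solution: "length ys = k" "sum_list ys = a * x"
    and monochromatic: "set (x # ys) \<subseteq> {z \<in> {1..n}. (z < ceil_div k a) = b}"
  show False
  proof (cases b)
    case True
    have "k * 1 \<le> a * x"
      using length_mult_le_sum_list[of ys 1] solution monochromatic by auto
    moreover have "x < ceil_div k a" using monochromatic True by simp
    ultimately show False using assms(1) by (simp add: less_ceil_div_iff)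
  next
    case False
    then have "ceil_div k a \<le> y" if "y \<in> set ys" for y
      using monochromatic that by auto
    then have "k * ceil_div k a \<le> a * x"
      using length_mult_le_sum_list[of ys "ceil_div k a"] solution by simp
    also have "\<dots> \<le> a * n" using monochromatic by simp
    finally show False
      using assms by (simp add: rado_bound_def less_ceil_div_iff)
  qed
qed

context solution_free_colouring
begin

lemma completion_forces_colour:
  assumes "length ys + j = k" "sum_list ys + j * x = a * x"
    and "set ys \<subseteq> {1..n}" "x \<in> {1..n}" "\<forall>y\<in>set ys. c y = b"
  shows "c x \<noteq> b"
proof
  assume "c x = b"
  let ?zs = "ys @ replicate j x"
  have "length ?zs = k" "sum_list ?zs = a * x"
    using assms(1,2) by (simp_all add: sum_list_replicate)
  moreover have "set ?zs \<subseteq> {1..n}" "\<forall>z\<in>set ?zs. c z = c x"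
    using assms(3-5) \<open>c x = b\<close> by auto
  ultimately show False
    using not_monochromatic \<open>x \<in> {1..n}\<close> by blast
qed

lemma two_values_force_colour:
  assumes "c u = b" "c v = b" "{u, v, x} \<subseteq> {1..n}" "i + j = k" "i * u + j * v = a * x"
  shows "c x \<noteq> b"
  using completion_forces_colour[of "replicate i u @ replicate j v" 0 x b] assms
  by (auto simp: sum_list_replicate set_replicate_conv_if)

lemma interval_forces_colour:
  assumes "\<forall>y\<in>{lo..hi}. c y = b" "1 \<le> lo" "lo \<le> hi" "hi \<le> n"
    and "j \<le> k" "j \<le> a" "(k - j) * lo \<le> (a - j) * x" "(a - j) * x \<le> (k - j) * hi" "x \<in> {1..n}"
  shows "c x \<noteq> b"
proof -
  obtain ys where ys: "length ys = k - j" "set ys \<subseteq> {lo..hi}" "sum_list ys = (a - j) * x"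
    using exists_list_sum_in_interval[of "k - j" lo "(a - j) * x" hi] assms by blast
  have "sum_list ys + j * x = a * x"
    using ys(3) \<open>j \<le> a\<close> by (simp flip: add_mult_distrib)
  moreover have "length ys + j = k" using ys(1) \<open>j \<le> k\<close> by simp
  moreover have "set ys \<subseteq> {1..n}" "\<forall>y\<in>set ys. c y = b"
    using ys(2) assms(1,2,4) by auto
  ultimately show ?thesis
    using completion_forces_colour \<open>x \<in> {1..n}\<close> by blast
qed

lemma one_and_three_force_colour:
  assumes "c 1 = b" "c 3 = b" "3 \<le> n" "x \<in> {1..n}"
    and "k \<le> a * x" "a * x \<le> 3 * k" "even (a * x + k)"
  shows "c x \<noteq> b"
proof -
  have "even (a * x - k)" using assms by simp
  then obtain j where "a * x - k = 2 * j" by blast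
  then have "(k - j) * 1 + j * 3 = a * x" "j \<le> k" using assms by linarith+
  then show ?thesis
    using two_values_force_colour[of 1 b 3 x "k - j" j] assms by simp
qed

lemma least_opposite_colourE:
  assumes "1 \<le> q" "q \<le> n" "k \<le> a * q" "a \<le> k"
  obtains y where "1 < y" "y \<le> q" "c y \<noteq> c 1" "\<forall>z\<in>{1..y - 1}. c z = c 1"
proof -
  have "\<exists>y. y \<in> {1..q} \<and> c y \<noteq> c 1"
  proof (rule ccontr)
    assume "\<not> ?thesis"
    then have same: "\<forall>y\<in>{1..q}. c y = c 1" by blast
    have "c q \<noteq> c 1"
      by (rule interval_forces_colour[OF same, of 0]) (use assms in simp_all)
    moreover have "q \<in> {1..q}" using assms(1) by simp
    ultimately show False using same by blast
  qed
  then obtain y where y: "y \<in> {1..q}" "c y \<noteq> c 1"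
    and least: "\<forall>z<y. \<not> (z \<in> {1..q} \<and> c z \<noteq> c 1)"
    by (subst (asm) exists_least_iff) blast
  have "y \<noteq> 1" using y(2) by blast
  with y(1) have "1 < y" "y \<le> q" by simp_all
  moreover have "\<forall>z\<in>{1..y - 1}. c z = c 1"
  proof
    fix z assume "z \<in> {1..y - 1}"
    then have "z < y" "z \<in> {1..q}" using \<open>1 < y\<close> \<open>y \<le> q\<close> by auto
    then show "c z = c 1" using least by blast
  qed
  ultimately show ?thesis using that y(2) by blast
qed

end

lemma same_parity_summandsE:
  fixes k :: nat
  assumes "7 \<le> k"
  obtains s t where "2 * s + t = k + 6" "k \<le> 3 * s" "s \<le> k" "even (s + k)"
    "k \<le> 3 * t" "t \<le> k" "even (t + k)"
proof
  let ?r = "(k + 2) div 3"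
  define s where "s = (if even (?r + k) then ?r else ?r + 1)"
  define t where "t = k + 6 - 2 * s"
  have s: "k \<le> 3 * s" "3 * s \<le> k + 5" "even (s + k)"
    by (auto simp: s_def)
  have sum: "2 * s + t = k + 6" using s assms unfolding t_def by linarith
  show "2 * s + t = k + 6" "k \<le> 3 * s" "even (s + k)" by fact+
  have "3 \<le> s" using s assms by linarith
  then show "s \<le> k" "k \<le> 3 * t" "t \<le> k" using s sum assms by linarith+
  have "t + k = 2 * (k + 3 - s)" using sum by linarith
  then show "even (t + k)" by simp
qed

lemma triple_and_summandE:
  fixes k q y :: nat
  assumes "7 \<le> k" and q: "k \<le> 3 * q" "3 * q < k + 3" and y: "3 \<le> y" "y \<le> q"
  obtains Z u where "3 * Z = u + (k - 1) * y" "3 * Z \<le> k * q + 2"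
    "k - 2 \<le> Z" "Z \<le> (k - 2) * (y - 1)" "q \<le> u" "3 * u \<le> k * 2"
proof
  define Z where "Z = ((k - 1) * y + q + 2) div 3"
  define e where "e = 3 * Z - ((k - 1) * y + q)"
  have Z: "3 * Z = (k - 1) * y + q + e" and e: "e \<le> 2"
    unfolding e_def Z_def by auto
  show "3 * Z = (q + e) + (k - 1) * y" using Z by simp
  have "(k - 1) * y + q \<le> (k - 1) * q + q" using y by simp
  also have "\<dots> = k * q" using assms(1) by (cases k) auto
  finally show "3 * Z \<le> k * q + 2" using Z e by simp
  obtain j v where shift: "k = j + 7" "y = v + 3"
    using assms(1) y(1) by (metis le_Suc_ex add.commute)
  show "k - 2 \<le> Z" "Z \<le> (k - 2) * (y - 1)"
    using Z e q by (simp_all add: shift algebra_simps)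
  show "q \<le> q + e" by simp
  show "3 * (q + e) \<le> k * 2"
  proof (cases "k = 7")
    case True
    then have "q = 3" "y = 3" using q y by linarith+
    then have "3 * Z = 21 + e" using Z True by simp
    then have "e = 0" using e by presburger
    with True \<open>q = 3\<close> show ?thesis by simp
  next
    case False
    then show ?thesis using assms(1) q e by simp
  qed
qed

locale solution_free_colouring_three = solution_free_colouring k 3 n c
  for k n :: nat and c :: "nat \<Rightarrow> bool"
begin

lemma colour_three_eq_if_two_neq:
  assumes "6 \<le> k" "k \<le> n + 2" "c 2 \<noteq> c 1"
  shows "c 3 = c 1"
proof (rule ccontr)
  assume "c 3 \<noteq> c 1"
  with assms(3) have "\<forall>y\<in>{2..3}. c y = c 2"
    by (auto simp: numeral_eq_Suc le_Suc_eq)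
  then have "c (k - 2) \<noteq> c 2"
    by (rule interval_forces_colour[where j = 0]) (use assms(1,2) in auto)
  moreover have "\<forall>y\<in>{1..1}. c y = c 1" by simp
  then have "c (k - 2) \<noteq> c 1"
    by (rule interval_forces_colour[where j = 2]) (use assms(1,2) in auto)
  ultimately show False using assms(3) by blast
qed

lemma colour_two_eq_colour_one:
  assumes "7 \<le> k" "k \<le> n"
  shows "c 2 = c 1"
proof (rule ccontr)
  assume two_neq: "c 2 \<noteq> c 1"
  have "c 3 = c 1" using colour_three_eq_if_two_neq assms two_neq by simp
  then have opposite: "c x \<noteq> c 1" if "k \<le> 3 * x" "x \<le> k" "even (x + k)" for x
    using one_and_three_force_colour[of "c 1" x] that assms by auto
  obtain s t where summands: "2 * s + t = k + 6" "k \<le> 3 * s" "s \<le> k" "even (s + k)"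
    "k \<le> 3 * t" "t \<le> k" "even (t + k)"
    using same_parity_summandsE[OF assms(1)] by blast
  have "c s = c 2" "c t = c 2" and c_k: "c k = c 2"
    using opposite[of s] opposite[of t] opposite[of k] summands two_neq assms by auto
  then have "c k \<noteq> c 2"
    using completion_forces_colour[of "[s, s, t] @ replicate (k - 3) 2" 0 k "c 2"] summands assms
    by (auto simp: sum_list_replicate set_replicate_conv_if)
  with c_k show False by simp
qed

lemma colour_eq_colour_one_if_below:
  assumes "7 \<le> k" and q: "k \<le> 3 * q" "3 * q < k + 3" and n: "k \<le> n" "k * q \<le> 3 * n"
    and y: "3 \<le> y" "y \<le> q" and below: "\<forall>z\<in>{1..y - 1}. c z = c 1"
  shows "c y = c 1"
proof (rule ccontr)
  assume opposite_y: "c y \<noteq> c 1"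
  obtain Z u where Z: "3 * Z = u + (k - 1) * y" "3 * Z \<le> k * q + 2"
      "k - 2 \<le> Z" "Z \<le> (k - 2) * (y - 1)"
    and u: "q \<le> u" "3 * u \<le> k * 2"
    using triple_and_summandE[OF assms(1) q y] by blast
  have "y - 1 \<le> n" using y q n(1) by linarith
  moreover have "1 \<le> Z" "Z \<le> n" using Z(2,3) n(2) assms(1) by linarith+
  moreover have "1 \<le> u" "u \<le> n" using u y q n(1) by linarith+
  moreover have "1 \<le> y" "y \<le> n" using y q n(1) by linarith+
  ultimately have range: "y - 1 \<le> n" "Z \<in> {1..n}" "u \<in> {1..n}" "y \<in> {1..n}" by simp_all
  have "c Z \<noteq> c 1"
    by (rule interval_forces_colour[OF below, of 2]) (use Z y range assms(1) in simp_all)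
  moreover have "c u \<noteq> c 1"
  proof (rule interval_forces_colour[OF below, of 0])
    have "3 * u \<le> k * 2" by fact
    also have "\<dots> \<le> k * (y - 1)" using y by (intro mult_le_mono) simp_all
    finally show "(3 - 0) * u \<le> (k - 0) * (y - 1)" by simp
  qed (use u q y range in simp_all)
  ultimately have "c u = c Z" "c y = c Z" using opposite_y by blast+
  then show False
    using two_values_force_colour[of u "c Z" y Z 1 "k - 1"] range Z(1) assms(1) by simp
qed

lemma less_rado_bound:
  assumes "7 \<le> k"
  shows "n < rado_bound k 3"
proof (rule ccontr)
  define q where "q = ceil_div k 3"
  have q: "k \<le> 3 * q" "3 * q < k + 3"
    using le_mult_ceil_div[of 3 k] mult_ceil_div_less[of 3 k] by (simp_all add: q_def)
  have "k * 3 \<le> k * q" using q assms by simp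
  moreover assume "\<not> n < rado_bound k 3"
  then have bound_le: "k * q \<le> 3 * n"
    by (simp add: rado_bound_def q_def not_less ceil_div_le_iff)
  ultimately have "k \<le> n" by linarith
  have "1 \<le> q" "q \<le> n" using q assms \<open>k \<le> n\<close> by linarith+
  then obtain y where y: "1 < y" "y \<le> q" "c y \<noteq> c 1" "\<forall>z\<in>{1..y - 1}. c z = c 1"
    by (rule least_opposite_colourE) (use q assms in linarith)+
  have "y \<noteq> 2" using colour_two_eq_colour_one[OF assms \<open>k \<le> n\<close>] y(3) by auto
  with y(1) have "3 \<le> y" by simp
  then show False
    using colour_eq_colour_one_if_below[OF assms q \<open>k \<le> n\<close> bound_le] y by blast
qed

end

lemma not_solution_free_colouring_6_3_4: "\<not> solution_free_colouring 6 3 4 c"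
proof
  assume "solution_free_colouring 6 3 4 c"
  then interpret solution_free_colouring 6 3 4 c .
  have "c 2 \<noteq> c 1" using completion_forces_colour[of "[1,1,1,1,1,1]" 0 2 "c 1"] by simp
  moreover have "c 4 \<noteq> c 2" using completion_forces_colour[of "[2,2,2,2,2,2]" 0 4 "c 2"] by simp
  moreover have "c 4 \<noteq> c 1" using completion_forces_colour[of "[1,1,1,1]" 2 4 "c 1"] by simp
  ultimately show False by blast
qed

lemma rado_bound_6_3: "rado_bound 6 3 = 4"
proof -
  have "rado_bound 6 3 \<le> 4" "3 < rado_bound 6 3"
    by (simp_all add: rado_bound_def ceil_div_def)
  then show ?thesis by simp
qed

lemma is_rado_number_rado_bound:
  assumes "6 \<le> k"
  shows "is_rado_number (Suc k) 3 (rado_bound k 3)"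
proof -
  have "\<not> solution_free_colouring k 3 (rado_bound k 3) c" for c
    using solution_free_colouring_three.less_rado_bound[of k "rado_bound k 3" c] assms
      not_solution_free_colouring_6_3_4
    by (cases "k = 6") (auto simp: rado_bound_6_3 solution_free_colouring_three_def)
  moreover have "0 < rado_bound k 3"
    using assms by (simp add: rado_bound_def less_ceil_div_iff)
  then obtain n where "rado_bound k 3 = Suc n"
    using gr0_conv_Suc by blast
  ultimately show ?thesis
    using is_rado_number_SucI[OF solution_free_colouring_below_rado_bound[of 3 n k]] by simp
qed

lemma solution_free_colouring_5_3_4: "solution_free_colouring 5 3 4 (\<lambda>x. x mod 3 = 1)"
proof (rule solution_free_colouringI)
  fix ys :: "nat list" and x b
  assume solution: "length ys = 5" "sum_list ys = 3 * x"
    and monochromatic: "set (x # ys) \<subseteq> {z \<in> {1..4}. (z mod 3 = 1) = b}"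
  show False
  proof (cases b)
    case True
    then have "sum_list ys mod 3 = length ys * 1 mod 3"
      using monochromatic by (intro sum_list_mod_const) auto
    then show False using solution by simp
  next
    case False
    have "z \<in> {2, 3}" if "z \<in> {1..4}" "z mod 3 \<noteq> 1" for z :: nat
      using that by (simp, presburger)
    then have two_or_three: "set (x # ys) \<subseteq> {2, 3}" using monochromatic False by blast
    then have "5 * 2 \<le> 3 * x"
      using length_mult_le_sum_list[of ys 2] solution by fastforce
    moreover have "x \<le> 3" using two_or_three by auto
    ultimately show False by simp
  qed
qed

lemma not_solution_free_colouring_5_3_5: "\<not> solution_free_colouring 5 3 5 c"
proof
  assume "solution_free_colouring 5 3 5 c"
  then interpret solution_free_colouring 5 3 5 c .
  have "c 2 \<noteq> c 1" using completion_forces_colour[of "[1,1,1,1]" 1 2 "c 1"] by simp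
  moreover have "c 3 \<noteq> c 1" using completion_forces_colour[of "[1,1,1]" 2 3 "c 1"] by simp
  ultimately have "c 3 = c 2" by blast
  then have "c 4 \<noteq> c 2" using completion_forces_colour[of "[2,2,2,3,3]" 0 4 "c 2"] by simp
  moreover have "c 5 \<noteq> c 3" using completion_forces_colour[of "[3,3,3,3,3]" 0 5 "c 3"] by simp
  ultimately have "c 4 = c 1" "c 5 = c 1" using \<open>c 2 \<noteq> c 1\<close> \<open>c 3 \<noteq> c 1\<close> by blast+
  then show False using completion_forces_colour[of "[5,1,1,1]" 1 4 "c 1"] by simp
qed

lemma is_rado_number_6_3_5: "is_rado_number 6 3 5"
  using is_rado_number_SucI[OF solution_free_colouring_5_3_4] not_solution_free_colouring_5_3_5
  by simp

lemma solution_free_colouring_4_3_3: "solution_free_colouring 4 3 3 even"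
proof (rule solution_free_colouringI)
  fix ys :: "nat list" and x b
  assume solution: "length ys = 4" "sum_list ys = 3 * x"
    and monochromatic: "set (x # ys) \<subseteq> {z \<in> {1..3}. even z = b}"
  show False
  proof (cases b)
    case True
    have "z = 2" if "z \<in> {1..3}" "even z" for z :: nat
      using that by (simp, presburger)
    then have twos: "set (x # ys) \<subseteq> {2}" using monochromatic True by blast
    then have "4 * 2 \<le> 3 * x"
      using length_mult_le_sum_list[of ys 2] solution by fastforce
    with twos show False by simp
  next
    case False
    then have "odd z" if "z \<in> set (x # ys)" for z using monochromatic that by blast
    then have "odd x" "sum_list ys mod 2 = length ys * 1 mod 2"
      by (simp, intro sum_list_mod_const) (simp add: odd_iff_mod_2_eq_one)
    then show False using solution by presburger
  qed
qed

lemma not_solution_free_colouring_4_3_4: "\<not> solution_free_colouring 4 3 4 c"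
proof
  assume "solution_free_colouring 4 3 4 c"
  then interpret solution_free_colouring 4 3 4 c .
  have "c 2 \<noteq> c 1" using completion_forces_colour[of "[1,1]" 2 2 "c 1"] by simp
  moreover have "c 3 \<noteq> c 2" using completion_forces_colour[of "[2,2,2]" 1 3 "c 2"] by simp
  moreover have "c 4 \<noteq> c 2" using completion_forces_colour[of "[2,2]" 2 4 "c 2"] by simp
  ultimately have "c 3 = c 1" "c 4 = c 1" by blast+
  then show False using completion_forces_colour[of "[1,1,4]" 1 3 "c 1"] by simp
qed

lemma is_rado_number_5_3_4: "is_rado_number 5 3 4"
  using is_rado_number_SucI[OF solution_free_colouring_4_3_3] not_solution_free_colouring_4_3_4
  by simp

lemma is_rado_number_4_3_1: "is_rado_number 4 3 1"
proof -
  have "solution_free_colouring 3 3 0 c" for c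
    by unfold_locales simp
  moreover have "\<not> solution_free_colouring 3 3 1 c" for c
    using solution_free_colouring.not_monochromatic[of 3 3 1 c "[1,1,1]" 1] by auto
  ultimately show ?thesis using is_rado_number_SucI[of 3 3 0] by simp
qed

lemma solution_free_colouring_2_3_8:
  "solution_free_colouring 2 3 8 (\<lambda>x. x \<in> {1,3,4,7})"
proof (rule solution_free_colouringI)
  fix ys :: "nat list" and x b
  assume solution: "length ys = 2" "sum_list ys = 3 * x"
    and monochromatic: "set (x # ys) \<subseteq> {z \<in> {1..8}. (z \<in> {1,3,4,7}) = b}"
  from solution obtain u v where uv: "ys = [u, v]" and sum: "u + v = 3 * x"
    by (auto simp: numeral_eq_Suc length_Suc_conv)
  show False
  proof (cases b)
    case True
    then have "x \<in> {1,3,4,7}" "u \<in> {1,3,4,7}" "v \<in> {1,3,4,7}" using monochromatic uv by auto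
    then show False using sum by auto
  next
    case False
    have "z \<in> {2,5,6,8}" if "z \<in> {1..8}" "z \<notin> {1,3,4,7}" for z :: nat
      using that by auto
    then have "set (x # ys) \<subseteq> {2,5,6,8}" using monochromatic False by blast
    then have "x \<in> {2,5,6,8}" "u \<in> {2,5,6,8}" "v \<in> {2,5,6,8}" using uv by simp_all
    then show False using sum by auto
  qed
qed

lemma not_solution_free_colouring_2_3_9: "\<not> solution_free_colouring 2 3 9 c"
proof
  assume "solution_free_colouring 2 3 9 c"
  then interpret solution_free_colouring 2 3 9 c .
  have "c 2 \<noteq> c 4" using completion_forces_colour[of "[4]" 1 2 "c 4"] by simp
  moreover have "c 2 \<noteq> c 3" using completion_forces_colour[of "[3,3]" 0 2 "c 3"] by simp
  ultimately have "c 4 = c 3" by blast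
  have "c 3 \<noteq> c 6" using completion_forces_colour[of "[6]" 1 3 "c 6"] by simp
  moreover have "c 4 \<noteq> c 9"
    using completion_forces_colour[of "[3,9]" 0 4 "c 9"] \<open>c 4 = c 3\<close> by auto
  moreover have "c 3 \<noteq> c 5"
    using completion_forces_colour[of "[4,5]" 0 3 "c 5"] \<open>c 4 = c 3\<close> by auto
  ultimately have "c 6 = c 5" "c 9 = c 5" using \<open>c 4 = c 3\<close> by blast+
  then show False using completion_forces_colour[of "[6,9]" 0 5 "c 5"] by simp
qed

lemma is_rado_number_3_3_9: "is_rado_number 3 3 9"
  using is_rado_number_SucI[OF solution_free_colouring_2_3_8] not_solution_free_colouring_2_3_9
  by simp

theorem theorem2:
  shows "(\<forall>m::nat. m \<ge> 7 \<longrightarrow>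
            is_rado_number m 3
              (nat \<lceil>(real (m - 1) / 3) * real_of_int \<lceil>real (m - 1) / 3\<rceil>\<rceil>))
         \<and> is_rado_number 6 3 5 \<and> is_rado_number 5 3 4
         \<and> is_rado_number 4 3 1 \<and> is_rado_number 3 3 9"
proof (intro conjI allI impI)
  fix m :: nat
  assume "7 \<le> m"
  then have "is_rado_number (Suc (m - 1)) 3 (rado_bound (m - 1) 3)"
    by (intro is_rado_number_rado_bound) simp
  with \<open>7 \<le> m\<close> show "is_rado_number m 3
      (nat \<lceil>(real (m - 1) / 3) * real_of_int \<lceil>real (m - 1) / 3\<rceil>\<rceil>)"
    by (simp add: rado_bound_eq_ceiling)
qed (fact is_rado_number_6_3_5 is_rado_number_5_3_4 is_rado_number_4_3_1 is_rado_number_3_3_9)+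

end
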